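(* Suppose $G$ is a finite simple connected graph, and let $k,d,k',d'$ be positive integers satisfying \[1\le k-1\le d\le\mathrm{diam}(G)\quad\text{and}\quad 1\le k'-1\le d'\le\mathrm{diam}(G).\] If $d'\le d$ and $k'\ge k$, then \[\alpha^k_d(G)\le\alpha^{k'}_{d'}(G),\quad \chi^k_d(G)\ge\chi^{k'}_{d'}(G),\quad \omega^k_d(G)\ge\omega^{k'}_{d'}(G),\quad \gamma^k_d(G)\le\gamma^{k'}_{d'}(G).\]
   Context: A shortest path in a graph $G$ is a path between some vertices $u,v$ whose length (number of edges) equals the graph distance between $u$ and $v$. A set $S\subseteq V(G)$ is $k,d$-independent in $G$ if every shortest path in $G$ of length at most $d$ contains fewer than $k$ vertices of $S$; $\alpha^k_d(G)$ is the supremum of the sizes of $k,d$-independent sets. $\chi^k_d(G)$ is the least positive integer $c$ such that some coloring $V(G)\to\{1,\dots,c\}$ has all color classes $k,d$-independent. A set $S\subseteq V(G)$ is a $k,d$-clique in $G$ if every $k$-element subset of $S$ is contained in some shortest path of $G$ of length at most $d$ (sets with fewer than $k$ elements are vacuously $k,d$-cliques); $\omega^k_d(G)$ is the supremum of the sizes of $k,d$-cliques in $G$. A set $D\subseteq V(G)$ is $k,d$-dominating in $G$ if for every $v\in V(G)\setminus D$ there is a shortest path $P$ in $G$ of length at most $d$ containing $v$ with $|V(P)\cap D|\ge k-1$; $\gamma^k_d(G)$ is the minimum size of a $k,d$-dominating set in $G$. *)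

theory Defs
  imports "Graph_Theory.Graph_Theory"
begin

text \<open>
  Finite simple graphs are rendered by the locale \<open>graph\<close> of the Graph_Theory entry: finite,
  loop-free digraphs without parallel arcs whose arc relation is symmetric.  Every undirected
  edge is a pair of opposite arcs, so a path is a directed path, given by its start vertex \<open>u\<close>
  and its list of arcs \<open>p\<close>; its length is \<open>length p\<close> and its vertex set is
  \<open>set (awalk_verts u p)\<close>.
\<close>

text \<open>
  The library's weighted distance \<open>\<mu>\<close> (an infimum of walk costs, in \<open>ereal\<close>) with all weights 1.
\<close>
definition graph_dist :: "('a, 'b) pre_digraph \<Rightarrow> 'a \<Rightarrow> 'a \<Rightarrow> ereal" where
  "graph_dist G u v = wf_digraph.\<mu> G (\<lambda>_. 1) u v"

definition diam :: "('a, 'b) pre_digraph \<Rightarrow> ereal" where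
  "diam G = (SUP u \<in> verts G. SUP v \<in> verts G. graph_dist G u v)"

definition shortest_path :: "('a, 'b) pre_digraph \<Rightarrow> 'a \<Rightarrow> 'b list \<Rightarrow> 'a \<Rightarrow> bool" where
  "shortest_path G u p v \<longleftrightarrow>
     pre_digraph.apath G u p v \<and> ereal (real (length p)) = graph_dist G u v"

definition kd_independent :: "('a, 'b) pre_digraph \<Rightarrow> nat \<Rightarrow> nat \<Rightarrow> 'a set \<Rightarrow> bool" where
  "kd_independent G k d S \<longleftrightarrow> S \<subseteq> verts G \<and>
     (\<forall>u p v. shortest_path G u p v \<and> length p \<le> d \<longrightarrow>
        card (set (pre_digraph.awalk_verts G u p) \<inter> S) < k)"

definition kd_clique :: "('a, 'b) pre_digraph \<Rightarrow> nat \<Rightarrow> nat \<Rightarrow> 'a set \<Rightarrow> bool" where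
  "kd_clique G k d S \<longleftrightarrow> S \<subseteq> verts G \<and>
     (\<forall>T. T \<subseteq> S \<and> finite T \<and> card T = k \<longrightarrow>
        (\<exists>u p v. shortest_path G u p v \<and> length p \<le> d \<and>
           T \<subseteq> set (pre_digraph.awalk_verts G u p)))"

definition kd_dominating :: "('a, 'b) pre_digraph \<Rightarrow> nat \<Rightarrow> nat \<Rightarrow> 'a set \<Rightarrow> bool" where
  "kd_dominating G k d D \<longleftrightarrow> D \<subseteq> verts G \<and>
     (\<forall>x \<in> verts G - D. \<exists>u p v. shortest_path G u p v \<and> length p \<le> d \<and>
        x \<in> set (pre_digraph.awalk_verts G u p) \<and>
        card (set (pre_digraph.awalk_verts G u p) \<inter> D) \<ge> k - 1)"

text \<open>
  The parameters below are natural numbers and are meant for finite graphs only, where the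
  suprema range over finite nonempty sets of naturals (for \<open>k > 0\<close>, the empty set is both
  independent and a clique).  The least elements exist as well: for \<open>k \<ge> 2\<close> an injective
  coloring is admissible, and \<open>verts G\<close> is always dominating.
\<close>
definition kd_independence_number :: "('a, 'b) pre_digraph \<Rightarrow> nat \<Rightarrow> nat \<Rightarrow> nat" where
  "kd_independence_number G k d = Sup {card S | S. kd_independent G k d S}"

definition kd_chromatic_number :: "('a, 'b) pre_digraph \<Rightarrow> nat \<Rightarrow> nat \<Rightarrow> nat" where
  "kd_chromatic_number G k d = (LEAST c. c > 0 \<and>
     (\<exists>f. f ` verts G \<subseteq> {1..c} \<and>
        (\<forall>i \<in> {1..c}. kd_independent G k d {v \<in> verts G. f v = i})))"

definition kd_clique_number :: "('a, 'b) pre_digraph \<Rightarrow> nat \<Rightarrow> nat \<Rightarrow> nat" where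
  "kd_clique_number G k d = Sup {card S | S. kd_clique G k d S}"

definition kd_domination_number :: "('a, 'b) pre_digraph \<Rightarrow> nat \<Rightarrow> nat \<Rightarrow> nat" where
  "kd_domination_number G k d = (LEAST n. \<exists>D. kd_dominating G k d D \<and> card D = n)"

end

theory Submission
  imports Defs
begin

text \<open>
  Being independent is preserved, and being dominating is reflected, when \<open>k\<close> grows and \<open>d\<close>
  shrinks, which settles \<open>\<alpha>\<close>, \<open>\<chi>\<close> and \<open>\<gamma>\<close>.  For \<open>\<omega>\<close>, a \<open>k',d'\<close>-clique with at least \<open>k'\<close>
  vertices is a \<open>k,d\<close>-clique, because each of its \<open>k\<close>-subsets extends to a \<open>k'\<close>-subset.  A
  smaller one, which may be a clique only vacuously, has at most \<open>k' - 1 \<le> d' \<le> d\<close> vertices and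
  is thus beaten by the \<open>d + 1\<close> vertices of a shortest path of length \<open>d\<close>, which exists since
  \<open>d\<close> is at most the diameter.
\<close>

text \<open>A smaller \<open>d'\<close> leaves fewer paths to test, and a larger \<open>k'\<close>
  loosens the bound on each of them.\<close>

lemma kd_independent_mono:
  assumes "kd_independent G k d S" "k \<le> k'" "d' \<le> d"
  shows "kd_independent G k' d' S"
  using assms unfolding kd_independent_def by (meson le_trans less_le_trans)

text \<open>The path that serves a vertex for \<open>k'\<close> and \<open>d'\<close> also serves it
  for \<open>k\<close> and \<open>d\<close>: both the length bound and the required count only get
  weaker.\<close>

lemma kd_dominating_antimono:
  assumes "kd_dominating G k' d' D" "k \<le> k'" "d' \<le> d"
  shows "kd_dominating G k d D"
  unfolding kd_dominating_def
proof (intro conjI ballI)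
  show "D \<subseteq> verts G" using assms(1) by (simp add: kd_dominating_def)
next
  fix x assume "x \<in> verts G - D"
  then obtain u p v where "shortest_path G u p v" "length p \<le> d'"
      "x \<in> set (pre_digraph.awalk_verts G u p)"
      "k' - 1 \<le> card (set (pre_digraph.awalk_verts G u p) \<inter> D)"
    using assms(1) unfolding kd_dominating_def by blast
  moreover have "length p \<le> d" using \<open>length p \<le> d'\<close> assms(3) by simp
  moreover have "k - 1 \<le> card (set (pre_digraph.awalk_verts G u p) \<inter> D)"
    using calculation(4) assms(2) by linarith
  ultimately show "\<exists>u p v. shortest_path G u p v \<and> length p \<le> d \<and>
      x \<in> set (pre_digraph.awalk_verts G u p) \<and>
      k - 1 \<le> card (set (pre_digraph.awalk_verts G u p) \<inter> D)"
    by blast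
qed

lemma kd_clique_antimono:
  assumes "kd_clique G k' d' S" "k \<le> k'" "d' \<le> d" "finite S" "k' \<le> card S"
  shows "kd_clique G k d S"
  unfolding kd_clique_def
proof (intro conjI allI impI)
  show "S \<subseteq> verts G" using assms(1) by (simp add: kd_clique_def)
next
  fix T assume T: "T \<subseteq> S \<and> finite T \<and> card T = k"
  obtain T' where T': "T \<subseteq> T'" "T' \<subseteq> S" "card T' = k'"
    using exists_subset_between[of T k' S] T assms by auto
  have "finite T'" using T'(2) assms(4) by (rule finite_subset)
  then obtain u p v where "shortest_path G u p v" "length p \<le> d'"
      "T' \<subseteq> set (pre_digraph.awalk_verts G u p)"
    using assms(1) T' unfolding kd_clique_def by blast
  then show "\<exists>u p v. shortest_path G u p v \<and> length p \<le> d \<and>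
      T \<subseteq> set (pre_digraph.awalk_verts G u p)"
    using T'(1) assms(3) by (meson le_trans subset_trans)
qed

text \<open>The path itself covers every subset of its vertices, whatever the value of
  \<open>k\<close>.\<close>

lemma (in wf_digraph) kd_clique_shortest_path:
  assumes "shortest_path G u p v" "length p \<le> d"
  shows "kd_clique G k d (set (awalk_verts u p))"
proof -
  have "awalk u p v" using assms(1) by (simp add: shortest_path_def apath_def)
  then have "set (awalk_verts u p) \<subseteq> verts G" by auto
  then show ?thesis using assms unfolding kd_clique_def by blast
qed

lemma (in wf_digraph) card_shortest_path_verts:
  assumes "shortest_path G u p v"
  shows "card (set (awalk_verts u p)) = Suc (length p)"
  using assms by (simp add: shortest_path_def apath_def distinct_card length_awalk_verts)

lemma (in wf_digraph) awalk_cost_unit: "awalk_cost (\<lambda>_. 1) p = real (length p)"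
  by (induction p) auto

text \<open>Unit weights admit no negative cycle, so the infimum \<open>\<mu>\<close> is attained by
  a path.\<close>

lemma (in fin_digraph) shortest_path_exists:
  assumes "u \<rightarrow>\<^sup>* v"
  obtains p where "shortest_path G u p v"
proof -
  have "0 \<le> awalk_cost (\<lambda>_. 1) c" for c
    by (simp add: awalk_cost_unit)
  then have "\<exists>p. apath u p v \<and> \<mu> (\<lambda>_. 1) u v = awalk_cost (\<lambda>_. 1) p"
    by (intro no_neg_cyc_reach_imp_path[OF assms]) (auto simp: not_less)
  then show thesis
    using that by (auto simp: shortest_path_def graph_dist_def awalk_cost_unit)
qed

lemma (in wf_digraph) graph_dist_le_length:
  assumes "awalk u p v"
  shows "graph_dist G u v \<le> ereal (real (length p))"
  using min_cost_le_walk_cost[OF assms, of "\<lambda>_. 1"]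
  by (simp add: graph_dist_def awalk_cost_unit)

text \<open>Exchange argument: replacing \<open>p\<close> by a shortest path \<open>r\<close> with
  the same ends gives a walk \<open>r @ q\<close> from \<open>u\<close> to \<open>v\<close>. It is
  no shorter than \<open>p @ q\<close>, so \<open>p\<close> is no longer than
  \<open>r\<close>.\<close>

lemma (in fin_digraph) shortest_path_prefix:
  assumes "shortest_path G u (p @ q) v"
  shows "shortest_path G u p (awlast u p)"
proof -
  have "apath u (p @ q) v" using assms by (simp add: shortest_path_def)
  then have p: "apath u p (awlast u p)" and q: "awalk (awlast u p) q v"
    by (simp_all add: apath_append_iff awalkI_apath)
  have "u \<rightarrow>\<^sup>* awlast u p" using p reachable_apath by blast
  then obtain r where r: "shortest_path G u r (awlast u p)"
    by (rule shortest_path_exists)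
  then have "awalk u r (awlast u p)" by (simp add: shortest_path_def apath_def)
  then have "awalk u (r @ q) v" using q by (rule awalk_appendI)
  then have "ereal (real (length (p @ q))) \<le> ereal (real (length (r @ q)))"
    using graph_dist_le_length assms by (simp only: shortest_path_def)
  moreover have "ereal (real (length r)) \<le> ereal (real (length p))"
    using graph_dist_le_length[OF awalkI_apath[OF p]] r by (simp only: shortest_path_def)
  ultimately have "length r = length p" by simp
  then show ?thesis using p r by (simp add: shortest_path_def)
qed

lemma (in fin_digraph) shortest_path_of_length:
  assumes "strongly_connected G" "ereal (real d) \<le> diam G"
  obtains u p v where "shortest_path G u p v" "length p = d"
proof -
  \<comment> \<open>A supremum yields a witness only for a strict lower bound. Half a unit of slack
    is harmless: path lengths are integers, so exceeding \<open>d - 1/2\<close> means being at least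
    \<open>d\<close>.\<close>
  have "ereal (real d - 1/2) < ereal (real d)" by simp
  also have "\<dots> \<le> diam G" by (fact assms(2))
  finally obtain u v where uv: "u \<in> verts G" "v \<in> verts G"
      and lt: "ereal (real d - 1/2) < graph_dist G u v"
    unfolding diam_def less_SUP_iff by blast
  have "u \<rightarrow>\<^sup>* v" using assms(1) uv by auto
  then obtain p where p: "shortest_path G u p v" by (rule shortest_path_exists)
  then have "ereal (real d - 1/2) < ereal (real (length p))"
    using lt by (simp only: shortest_path_def)
  then have "d \<le> length p" by simp
  \<comment> \<open>The path may be too long; its first \<open>d\<close> arcs still form a shortest
    path.\<close>
  moreover have "shortest_path G u (take d p) (awlast u (take d p))"
    using p by (intro shortest_path_prefix[where q = "drop d p"]) simp
  ultimately show thesis using that by simp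
qed

text \<open>On \<open>nat\<close>, \<open>Sup\<close> is only conditionally complete:
  \<open>S\<^sub>0\<close> makes the left set nonempty, and the finite \<open>V\<close> bounds the
  right one.\<close>

lemma Sup_card_le:
  fixes P Q :: "'a set \<Rightarrow> bool"
  assumes "finite V" "\<And>S. Q S \<Longrightarrow> S \<subseteq> V" "P S\<^sub>0"
    and "\<And>S. P S \<Longrightarrow> \<exists>T. Q T \<and> card S \<le> card T"
  shows "Sup {card S | S. P S} \<le> Sup {card S | S. Q S}"
proof (rule cSup_mono)
  show "{card S | S. P S} \<noteq> {}" using assms(3) by auto
  have "{card S | S. Q S} \<subseteq> {..card V}"
    using assms(1,2) by (auto intro: card_mono)
  then show "bdd_above {card S | S. Q S}" by (rule bdd_above_mono[rotated]) simp
  show "\<exists>m\<in>{card S | S. Q S}. n \<le> m" if "n \<in> {card S | S. P S}" for n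
    using that assms(4) by blast
qed

text \<open>The witness \<open>m\<close> ensures that the least number satisfying \<open>P\<close>
  exists; it then satisfies \<open>Q\<close> as well.\<close>

lemma Least_antimono:
  fixes P Q :: "nat \<Rightarrow> bool"
  assumes "\<And>n. P n \<Longrightarrow> Q n" "P m"
  shows "(LEAST n. Q n) \<le> (LEAST n. P n)"
  using assms by (meson LeastI Least_le)

text \<open>The color classes of an injective coloring have at most one vertex, which is fewer than
  \<open>k\<close>. This makes the \<open>LEAST\<close> in \<open>kd_chromatic_number\<close>
  meaningful.\<close>

lemma kd_coloring_exists:
  assumes "finite (verts G)" "2 \<le> k"
  shows "\<exists>c>(0::nat). \<exists>f. f ` verts G \<subseteq> {1..c} \<and>
    (\<forall>i \<in> {1..c}. kd_independent G k d {v \<in> verts G. f v = i})"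
proof -
  obtain f :: "'a \<Rightarrow> nat" where f: "inj_on f (verts G)"
    using assms(1) by (metis finite_imp_inj_to_nat_seg)
  \<comment> \<open>Colors start at 1, hence the shift.\<close>
  define g where "g = Suc \<circ> f"
  have "inj_on g (verts G)" using f by (auto simp: g_def inj_on_def)
  have "kd_independent G k d {v \<in> verts G. g v = i}" for i
    unfolding kd_independent_def
  proof (intro conjI allI impI)
    fix u p
    let ?A = "set (pre_digraph.awalk_verts G u p) \<inter> {v \<in> verts G. g v = i}"
    have "card ?A \<le> Suc 0"
      using \<open>inj_on g (verts G)\<close> by (simp add: card_le_Suc0_iff_eq inj_on_def)
    then show "card ?A < k" using assms(2) by simp
  qed auto
  moreover have "g ` verts G \<subseteq> {1..Suc (Max (g ` verts G))}"
  proof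
    fix i assume "i \<in> g ` verts G"
    then have "i \<le> Max (g ` verts G)" "1 \<le> i"
      using assms(1) by (auto simp: g_def)
    then show "i \<in> {1..Suc (Max (g ` verts G))}" by simp
  qed
  ultimately show ?thesis by (intro exI[of _ "Suc (Max (g ` verts G))"]) blast
qed

lemma kd_independence_number_mono:
  assumes "finite (verts G)" "k > 0" "k \<le> k'" "d' \<le> d"
  shows "kd_independence_number G k d \<le> kd_independence_number G k' d'"
  unfolding kd_independence_number_def
proof (rule Sup_card_le[OF assms(1)])
  \<comment> \<open>Every path meets the empty set in 0 vertices, and \<open>0 < k\<close>.\<close>
  show "kd_independent G k d {}" using assms(2) by (simp add: kd_independent_def)
  show "S \<subseteq> verts G" if "kd_independent G k' d' S" for S
    using that by (simp add: kd_independent_def)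
  show "\<exists>T. kd_independent G k' d' T \<and> card S \<le> card T" if "kd_independent G k d S" for S
    using kd_independent_mono[OF that assms(3,4)] by blast
qed

lemma kd_chromatic_number_antimono:
  assumes "finite (verts G)" "2 \<le> k" "k \<le> k'" "d' \<le> d"
  shows "kd_chromatic_number G k' d' \<le> kd_chromatic_number G k d"
proof -
  let ?P = "\<lambda>k d c. c > (0::nat) \<and> (\<exists>f. f ` verts G \<subseteq> {1..c} \<and>
      (\<forall>i \<in> {1..c}. kd_independent G k d {v \<in> verts G. f v = i}))"
  obtain c where "?P k d c"
    using kd_coloring_exists[OF assms(1,2), of d] by blast
  moreover have "?P k' d' c" if "?P k d c" for c
    using that by (meson kd_independent_mono[OF _ assms(3,4)])
  ultimately show ?thesis
    unfolding kd_chromatic_number_def by (intro Least_antimono[of "?P k d" "?P k' d'" c])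
qed

lemma kd_domination_number_mono:
  assumes "k \<le> k'" "d' \<le> d"
  shows "kd_domination_number G k d \<le> kd_domination_number G k' d'"
proof -
  \<comment> \<open>The whole vertex set dominates vacuously, so a least size exists.\<close>
  have "\<exists>D. kd_dominating G k' d' D \<and> card D = card (verts G)"
    by (intro exI[of _ "verts G"]) (simp add: kd_dominating_def)
  then show ?thesis
    unfolding kd_domination_number_def
    by (rule Least_antimono[rotated]) (use kd_dominating_antimono[OF _ assms] in blast)
qed

lemma (in fin_digraph) kd_clique_number_antimono:
  assumes "strongly_connected G" "ereal (real d) \<le> diam G"
    and "k' > 0" "k' - 1 \<le> d'" "k \<le> k'" "d' \<le> d"
  shows "kd_clique_number G k' d' \<le> kd_clique_number G k d"
  unfolding kd_clique_number_def
proof (rule Sup_card_le[OF finite_verts])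
  show "kd_clique G k' d' {}" using assms(3) by (simp add: kd_clique_def)
  show "S \<subseteq> verts G" if "kd_clique G k d S" for S
    using that by (simp add: kd_clique_def)
  show "\<exists>T. kd_clique G k d T \<and> card S \<le> card T" if S: "kd_clique G k' d' S" for S
  proof (cases "k' \<le> card S")
    case True
    have "finite S" using S finite_subset[OF _ finite_verts] by (simp add: kd_clique_def)
    then show ?thesis using kd_clique_antimono[OF S assms(5,6) _ True] by blast
  next
    case False
    obtain u p v where p: "shortest_path G u p v" "length p = d"
      using shortest_path_of_length[OF assms(1,2)] .
    have "card S \<le> card (set (awalk_verts u p))"
      using False p(2) assms(4,6) by (simp add: card_shortest_path_verts[OF p(1)])
    then show ?thesis using kd_clique_shortest_path[OF p(1)] p(2) by blast
  qed
qed

theorem proposition2p8: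
  fixes G :: "('a, 'b) pre_digraph" and k d k' d' :: nat
  assumes "graph G" and "Digraph_Component.connected G"
    and "k > 0" and "d > 0" and "k' > 0" and "d' > 0"
    and "1 \<le> k - 1" and "k - 1 \<le> d" and "ereal (real d) \<le> diam G"
    and "1 \<le> k' - 1" and "k' - 1 \<le> d'" and "ereal (real d') \<le> diam G"
    and "d' \<le> d" and "k' \<ge> k"
  shows "kd_independence_number G k d \<le> kd_independence_number G k' d' \<and>
         kd_chromatic_number G k d \<ge> kd_chromatic_number G k' d' \<and>
         kd_clique_number G k d \<ge> kd_clique_number G k' d' \<and>
         kd_domination_number G k d \<le> kd_domination_number G k' d'"
proof -
  interpret graph G by fact
  \<comment> \<open>Symmetry of the arcs turns connectedness into mutual reachability, from which
    shortest paths between all pairs are obtained.\<close>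
  have "strongly_connected G"
    using symmetric_connected_imp_strongly_connected[OF sym_arcs] assms(2) .
  then show ?thesis
    using kd_independence_number_mono[OF finite_verts, of k k' d' d]
      kd_chromatic_number_antimono[OF finite_verts, of k k' d' d]
      kd_clique_number_antimono[of d k' d' k] kd_domination_number_mono[of k k' d' d] assms
    by simp
qed

end
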